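(* Let $n\ge2$. The set of dominant, indivisible, $\mathfrak{p}^-$-admissible one-parameter subgroups of $T_{\mathbb{C}}$ associated to $G=Sp(2n,\mathbb{R})$ is $$\{(1,0,\dots,0),(0,\dots,0,-1)\}\cup\{\lambda_{k,l}:k=1,\dots,n-1,\ l=1,\dots,n-k\},$$ where $\lambda_{k,l}=(\underbrace{1,\dots,1}_{k},\underbrace{0,\dots,0}_{n-(k+l)},\underbrace{-1,\dots,-1}_{l})$. The cardinality of this set is $\frac{n(n-1)}{2}+2$.
   Context: For $G=Sp(2n,\mathbb{R})$ the maximal compact subgroup is $K\cong U(n)$, with complexification $GL_n(\mathbb{C})$; $T_{\mathbb{C}}$ is the torus of diagonal matrices of $GL_n(\mathbb{C})$. A one-parameter subgroup of $T_{\mathbb{C}}$ is $\lambda=(\lambda_1,\dots,\lambda_n)\in\mathbb{Z}^n$, i.e. $t\mapsto\mathrm{diag}(t^{\lambda_1},\dots,t^{\lambda_n})$. It is dominant if $\lambda_1\ge\dots\ge\lambda_n$, and indivisible if it is not $n'\lambda'$ with $n'>1$ an integer and $\lambda'\in\mathbb{Z}^n$. $\mathfrak{p}^-\cong\mathrm{S}^2((\mathbb{C}^n)^* )$ as a $U(n)$-module; its $T_{\mathbb{C}}$-weights are $-(e_i^*+e_j^* )$, $1\le i\le j\le n$. $\lambda$ is $\mathfrak{p}^-$-admissible if there is $v\in\mathfrak{p}^-$ such that $\lambda(\mathbb{C}^* )$ is the identity component of the stabilizer of $v$ in $T_{\mathbb{C}}$; equivalently, the line $\mathbb{C}\lambda\subset\mathfrak{t}_{\mathbb{C}}$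 is the intersection of the kernels of a family of weights of $\mathfrak{p}^-$. *)

theory Defs
  imports "HOL-Analysis.Analysis"
begin

text \<open>
  Coordinates are indexed by a finite linearly ordered type \<open>'n\<close>, so that \<open>n = CARD('n)\<close>.
  \<open>tuple [x\<^sub>1, \<dots>, x\<^sub>n]\<close> is the vector whose entries, read along the order of \<open>'n\<close>, are
  \<open>x\<^sub>1, \<dots>, x\<^sub>n\<close>; it is only used for lists of length \<open>CARD('n)\<close>.
\<close>

definition tuple :: "'a list \<Rightarrow> 'a ^ 'n::{finite,linorder}" where
  "tuple xs = (\<chi> i. xs ! card {j. j < i})"

definition torus :: "(complex ^ 'n ^ 'n) set" where
  "torus = {A. invertible A \<and> (\<forall>i j. i \<noteq> j \<longrightarrow> A $ i $ j = 0)}"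

text \<open>
  The \<open>GL\<^sub>n(\<complex>)\<close>-module \<open>\<pp>\<^sup>-\<close>, that is \<open>S\<^sup>2((\<complex>\<^sup>n)\<^sup>*)\<close>, is realised as the space of symmetric
  complex bilinear forms on \<open>\<complex>\<^sup>n\<close>, with \<open>g\<close> acting by \<open>(g \<cdot> B)(x, y) = B(g\<^sup>-\<^sup>1 x, g\<^sup>-\<^sup>1 y)\<close>;
  the form \<open>x\<^sub>i y\<^sub>j + x\<^sub>j y\<^sub>i\<close> then has weight \<open>-(e\<^sub>i\<^sup>* + e\<^sub>j\<^sup>*)\<close>.
  Linearity has to be stated over \<open>\<complex>\<close>, since the library constant \<^const>\<open>bilinear\<close> is real bilinearity.
\<close>

definition pminus :: "(complex ^ 'n \<Rightarrow> complex ^ 'n \<Rightarrow> complex) set" where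
  "pminus = {B. (\<forall>x. Vector_Spaces.linear (*s) (*) (\<lambda>y. B x y)) \<and>
                (\<forall>y. Vector_Spaces.linear (*s) (*) (\<lambda>x. B x y)) \<and>
                (\<forall>x y. B x y = B y x)}"

definition act :: "complex ^ 'n ^ 'n \<Rightarrow> (complex ^ 'n \<Rightarrow> complex ^ 'n \<Rightarrow> complex)
    \<Rightarrow> (complex ^ 'n \<Rightarrow> complex ^ 'n \<Rightarrow> complex)" where
  "act g B = (\<lambda>x y. B (matrix_inv g *v x) (matrix_inv g *v y))"

definition torus_stabilizer ::
    "(complex ^ 'n \<Rightarrow> complex ^ 'n \<Rightarrow> complex) \<Rightarrow> (complex ^ 'n ^ 'n) set" where
  "torus_stabilizer v = {g \<in> torus. act g v = v}"

definition one_param :: "int ^ 'n \<Rightarrow> complex \<Rightarrow> complex ^ 'n ^ 'n" where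
  "one_param \<mu> t = (\<chi> i j. if i = j then t powi (\<mu> $ i) else 0)"

definition dominant :: "int ^ 'n::{finite,linorder} \<Rightarrow> bool" where
  "dominant \<mu> \<longleftrightarrow> (\<forall>i j. i \<le> j \<longrightarrow> \<mu> $ j \<le> \<mu> $ i)"

definition indivisible :: "int ^ 'n \<Rightarrow> bool" where
  "indivisible \<mu> \<longleftrightarrow> \<not> (\<exists>m::int. \<exists>\<nu>. m > 1 \<and> \<mu> = m *s \<nu>)"

text \<open>
  The identity component is taken in the Euclidean topology; for a complex algebraic group such
  as the stabilizer it coincides with the identity component in the Zariski topology.
\<close>

definition pminus_admissible :: "int ^ 'n \<Rightarrow> bool" where
  "pminus_admissible \<mu> \<longleftrightarrow>
     (\<exists>v\<in>pminus. one_param \<mu> ` (- {0}) = connected_component_set (torus_stabilizer v) (mat 1))"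

definition lam :: "nat \<Rightarrow> nat \<Rightarrow> int ^ 'n::{finite,linorder}" where
  "lam k l = tuple (replicate k 1 @ replicate (CARD('n) - (k + l)) 0 @ replicate l (- 1))"

end

theory Submission imports Defs begin

text \<open>
  The diagonal matrix with entries \<open>d\<^sub>1, \<dots>, d\<^sub>n\<close> fixes a symmetric form \<open>v\<close> iff \<open>d\<^sub>i d\<^sub>j = 1\<close> whenever
  \<open>v(e\<^sub>i, e\<^sub>j) \<noteq> 0\<close>. If the identity component of the stabilizer is \<open>\<mu>(\<complex>\<^sup>*)\<close>, then the curves
  \<open>s \<mapsto> diag(exp(s x\<^sub>1), \<dots>, exp(s x\<^sub>n))\<close> show that every real vector \<open>x\<close> killed by the weights of \<open>v\<close> is
  a multiple of \<open>\<mu>\<close>. Taking for \<open>x\<close> the vector of signs of \<open>\<mu>\<close> gives entries in \<open>{-1, 0, 1}\<close>, and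
  taking a unit vector excludes two or more nonzero entries all of the same sign.
  Conversely, for such \<open>\<mu>\<close> take \<open>v\<close> to be supported on all weights killed by \<open>\<mu>\<close>: where \<open>\<mu>\<^sub>i = 0\<close> the
  stabilizer satisfies \<open>d\<^sub>i\<^sup>2 = 1\<close>, which forces \<open>d\<^sub>i = 1\<close> on the identity component.
\<close>

section \<open>Diagonal matrices and the torus\<close>

definition diag_mat :: "('n::finite \<Rightarrow> complex) \<Rightarrow> complex ^ 'n ^ 'n" where
  "diag_mat a = (\<chi> i j. if i = j then a i else 0)"

lemma diag_mat_nth: "diag_mat a $ i $ j = (if i = j then a i else 0)"
  by (simp add: diag_mat_def)

lemma diag_mat_eq_iff: "diag_mat a = diag_mat b \<longleftrightarrow> a = b"
  by (auto simp: vec_eq_iff diag_mat_nth fun_eq_iff)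

lemma one_param_eq_diag_mat: "one_param \<mu> t = diag_mat (\<lambda>i. t powi (\<mu> $ i))"
  by (simp add: one_param_def diag_mat_def)

lemma mat_1_eq_diag_mat: "mat 1 = diag_mat (\<lambda>_. 1)"
  by (simp add: mat_def diag_mat_def)

lemma if_zero_times: "(if P then a else 0) * b = (if P then a * b else (0 :: 'a :: mult_zero))"
  by simp

lemma diag_mat_mult: "diag_mat a ** diag_mat b = diag_mat (\<lambda>i. a i * b i)"
  by (simp add: vec_eq_iff matrix_matrix_mult_def diag_mat_nth if_zero_times)

lemma diag_mat_vector_mult: "diag_mat a *v x = (\<chi> i. a i * x $ i)"
  by (simp add: vec_eq_iff matrix_vector_mult_def diag_mat_nth if_zero_times)

lemma diag_mat_inverse:
  assumes "\<And>i. a i \<noteq> 0"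
  shows "diag_mat a ** diag_mat (\<lambda>i. inverse (a i)) = mat 1"
    and "diag_mat (\<lambda>i. inverse (a i)) ** diag_mat a = mat 1"
  using assms by (simp_all add: diag_mat_mult mat_1_eq_diag_mat)

lemma matrix_inv_diag_mat:
  assumes "\<And>i. a i \<noteq> 0"
  shows "matrix_inv (diag_mat a) = diag_mat (\<lambda>i. inverse (a i))"
proof -
  let ?A = "diag_mat a" and ?B = "diag_mat (\<lambda>i. inverse (a i))"
  \<comment> \<open>\<open>matrix_inv\<close> is a Hilbert choice, so the explicit inverse
    \<open>?B\<close> only shows that the chosen matrix is a two-sided inverse;
    \<open>M = M (A B) = (M A) B = B\<close> then identifies it.\<close>
  have "?A ** matrix_inv ?A = mat 1 \<and> matrix_inv ?A ** ?A = mat 1"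
    unfolding matrix_inv_def by (rule someI [of _ ?B]) (use assms diag_mat_inverse in blast)
  then have "matrix_inv ?A = matrix_inv ?A ** (?A ** ?B)" "matrix_inv ?A ** ?A = mat 1"
    using diag_mat_inverse [of a] assms by simp_all
  then show ?thesis
    by (simp add: matrix_mul_assoc)
qed

lemma torus_eq: "(torus :: (complex ^ 'n::finite ^ 'n) set) = {diag_mat a | a. \<forall>i. a i \<noteq> 0}"
proof safe
  fix A :: "complex ^ 'n ^ 'n"
  assume A: "A \<in> torus"
  then have "det A = (\<Prod>i\<in>UNIV. A $ i $ i)"
    by (auto simp: torus_def intro: det_diagonal)
  moreover have "det A \<noteq> 0"
    using A by (simp add: torus_def invertible_det_nz)
  ultimately have "\<forall>i. A $ i $ i \<noteq> 0"
    by auto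
  moreover have "A = diag_mat (\<lambda>i. A $ i $ i)"
    using A by (auto simp: torus_def vec_eq_iff diag_mat_nth)
  ultimately show "\<exists>a. A = diag_mat a \<and> (\<forall>i. a i \<noteq> 0)"
    by (intro exI [of _ "\<lambda>i. A $ i $ i"]) simp
next
  fix a :: "'n \<Rightarrow> complex"
  assume "\<forall>i. a i \<noteq> 0"
  then show "diag_mat a \<in> torus"
    using diag_mat_inverse [of a] by (auto simp: torus_def diag_mat_nth invertible_def)
qed

section \<open>Symmetric bilinear forms and their torus stabilizers\<close>

lemma pminus_expand:
  assumes "B \<in> pminus"
  shows "B x y = (\<Sum>i\<in>UNIV. \<Sum>j\<in>UNIV. x $ i * (y $ j * B (axis i 1) (axis j 1)))"
proof -
  have L: "Vector_Spaces.linear (*s) (*) (\<lambda>y. B x y)" "Vector_Spaces.linear (*s) (*) (\<lambda>x. B x y)" for x y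
    using assms by (auto simp: pminus_def)
  note L = L [unfolded linear_iff_module_hom]
  have "B x y = B (\<Sum>i\<in>UNIV. x $ i *s axis i 1) y"
    by (simp add: basis_expansion)
  also have "\<dots> = (\<Sum>i\<in>UNIV. x $ i * B (axis i 1) y)"
    by (simp add: module_hom.sum [OF L(2)] module_hom.scale [OF L(2)])
  also have "\<dots> = (\<Sum>i\<in>UNIV. x $ i * B (axis i 1) (\<Sum>j\<in>UNIV. y $ j *s axis j 1))"
    by (simp add: basis_expansion)
  also have "\<dots> = (\<Sum>i\<in>UNIV. \<Sum>j\<in>UNIV. x $ i * (y $ j * B (axis i 1) (axis j 1)))"
    by (simp add: module_hom.sum [OF L(1)] module_hom.scale [OF L(1)] sum_distrib_left)
  finally show ?thesis .
qed

text \<open>The coefficients on pairs of basis vectors determine a form, and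
  \<open>diag_mat a\<close> multiplies the coefficient at \<open>(i, j)\<close> by the inverse of
  \<open>a i * a j\<close>. A nonzero coefficient survives only if this factor is 1.\<close>

lemma act_diag_mat_eq_iff:
  fixes B :: "complex ^ 'n \<Rightarrow> complex ^ 'n \<Rightarrow> complex"
  assumes B: "B \<in> pminus" and a: "\<And>i. a i \<noteq> 0"
  shows "act (diag_mat a) B = B \<longleftrightarrow> (\<forall>i j. B (axis i 1) (axis j 1) \<noteq> 0 \<longrightarrow> a i * a j = 1)"
proof -
  have act: "act (diag_mat a) B x y =
      (\<Sum>i\<in>UNIV. \<Sum>j\<in>UNIV. x $ i * (y $ j * (inverse (a i) * (inverse (a j) * B (axis i 1) (axis j 1)))))" for x y
    unfolding act_def matrix_inv_diag_mat [OF a] diag_mat_vector_mult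
    by (subst pminus_expand [OF B]) (simp add: mult_ac)
  have L: "Vector_Spaces.linear (*s) (*) (\<lambda>y. B x y)" "Vector_Spaces.linear (*s) (*) (\<lambda>x. B x y)" for x y
    using B by (auto simp: pminus_def)
  note L = L [unfolded linear_iff_module_hom]
  have "diag_mat b *v axis i 1 = b i *s axis i 1" for b and i :: 'n
    by (auto simp: diag_mat_vector_mult vec_eq_iff axis_def)
  then have ax: "act (diag_mat a) B (axis i 1) (axis j 1) = inverse (a i) * (inverse (a j) * B (axis i 1) (axis j 1))" for i j
    by (simp only: act_def matrix_inv_diag_mat [OF a] module_hom.scale [OF L(1)] module_hom.scale [OF L(2)])
  have inv: "inverse (a i) * (inverse (a j) * b) = b \<longleftrightarrow> (b \<noteq> 0 \<longrightarrow> a i * a j = 1)" for i j b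
    using a [of i] a [of j] by (auto simp: field_simps)
  have 1: "\<forall>i j. B (axis i 1) (axis j 1) \<noteq> 0 \<longrightarrow> a i * a j = 1" if "act (diag_mat a) B = B"
    using ax unfolding that inv [symmetric] by metis
  have "act (diag_mat a) B = B" if "\<forall>i j. B (axis i 1) (axis j 1) \<noteq> 0 \<longrightarrow> a i * a j = 1"
  proof (intro ext)
    fix x y
    have *: "inverse (a i) * (inverse (a j) * B (axis i 1) (axis j 1)) = B (axis i 1) (axis j 1)" for i j
      using that inv by blast
    show "act (diag_mat a) B x y = B x y"
      unfolding act pminus_expand [OF B, of x y] by (simp only: *)
  qed
  with 1 show ?thesis by blast
qed

lemma torus_stabilizer_eq:
  assumes "B \<in> pminus"
  shows "torus_stabilizer B =
    {diag_mat a | a. (\<forall>i. a i \<noteq> 0) \<and> (\<forall>i j. B (axis i 1) (axis j 1) \<noteq> 0 \<longrightarrow> a i * a j = 1)}"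
  unfolding torus_stabilizer_def torus_eq by (auto simp: act_diag_mat_eq_iff [OF assms])

section \<open>Identity components of stabilizers and common kernels of weights\<close>

lemma continuous_on_diag_mat:
  assumes "\<And>i. continuous_on S (\<lambda>x. f x i)"
  shows "continuous_on S (\<lambda>x. diag_mat (f x))"
  unfolding diag_mat_def
proof (rule continuous_on_vec_lambda, rule continuous_on_vec_lambda)
  show "continuous_on S (\<lambda>x. if i = j then f x i else 0)" for i j
    using assms by (cases "i = j") auto
qed

text \<open>Passes from groups to linear algebra: \<open>S\<close> indexes the weights occurring in
  the form, and the multiples of \<open>\<mu>\<close> are exactly their common real kernel.\<close>

lemma pminus_admissible_kernel:
  fixes \<mu> :: "int ^ 'n"
  assumes "pminus_admissible \<mu>"
  obtains S where "\<And>i j. (i, j) \<in> S \<Longrightarrow> \<mu> $ i + \<mu> $ j = 0"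
    and "\<And>x :: 'n \<Rightarrow> real. (\<And>i j. (i, j) \<in> S \<Longrightarrow> x i + x j = 0) \<Longrightarrow> \<exists>c. \<forall>i. x i = c * of_int (\<mu> $ i)"
proof -
  obtain v where v: "v \<in> pminus"
    and eq: "one_param \<mu> ` (- {0}) = connected_component_set (torus_stabilizer v) (mat 1)"
    using assms by (auto simp: pminus_admissible_def)
  define S where "S = {(i, j). v (axis i 1) (axis j 1) \<noteq> 0}"
  have stab: "diag_mat a \<in> torus_stabilizer v \<longleftrightarrow> (\<forall>i. a i \<noteq> 0) \<and> (\<forall>(i, j) \<in> S. a i * a j = 1)" for a
    unfolding torus_stabilizer_eq [OF v] by (auto simp: S_def diag_mat_eq_iff)
  show thesis
  proof
    fix i j
    assume "(i, j) \<in> S"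
    \<comment> \<open>The parameter 2 is not a root of unity, so a power of it equals 1 only for
      exponent 0. Taking norms moves the equation to the reals, where \<open>powr_inj\<close>
      applies.\<close>
    have "one_param \<mu> 2 \<in> one_param \<mu> ` (- {0})"
      by (intro imageI) simp
    then have "one_param \<mu> 2 \<in> torus_stabilizer v"
      unfolding eq using connected_component_subset by blast
    with \<open>(i, j) \<in> S\<close> have "(2::complex) powi (\<mu> $ i) * 2 powi (\<mu> $ j) = 1"
      unfolding one_param_eq_diag_mat stab by auto
    then have "(2::complex) powi (\<mu> $ i + \<mu> $ j) = 1"
      by (simp add: power_int_add)
    then have "norm ((2::complex) powi (\<mu> $ i + \<mu> $ j)) = 1"
      by simp
    then have "(2::real) powi (\<mu> $ i + \<mu> $ j) = 2 powi 0"
      by (simp add: norm_power_int)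
    then have "(2::real) powr real_of_int (\<mu> $ i + \<mu> $ j) = 2 powr 0"
      by (subst powr_real_of_int') simp_all
    then show "\<mu> $ i + \<mu> $ j = 0"
      by (subst (asm) powr_inj) auto
  next
    fix x :: "'n \<Rightarrow> real"
    assume x: "\<And>i j. (i, j) \<in> S \<Longrightarrow> x i + x j = 0"
    \<comment> \<open>The real one-parameter subgroup in direction \<open>x\<close>. It is
      connected, passes through the identity and stays in the stabilizer, hence lies in the image of
      \<open>\<mu>\<close>.\<close>
    define g where "g = (\<lambda>s. diag_mat (\<lambda>i. exp (complex_of_real (s * x i))))"
    have "continuous_on UNIV g"
      unfolding g_def by (rule continuous_on_diag_mat) (intro continuous_intros)
    then have "connected (range g)"
      by (intro connected_continuous_image) auto
    moreover have "mat 1 \<in> range g"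
      by (rule range_eqI [of _ _ 0]) (simp add: g_def mat_1_eq_diag_mat)
    moreover have "range g \<subseteq> torus_stabilizer v"
    proof safe
      fix s
      have "exp (complex_of_real (s * x i)) * exp (complex_of_real (s * x j)) = 1" if "(i, j) \<in> S" for i j
      proof -
        have "s * x i + s * x j = 0"
          using x [OF that] by (metis distrib_left mult_zero_right)
        then show ?thesis
          by (metis exp_add exp_zero of_real_0 of_real_add)
      qed
      then show "g s \<in> torus_stabilizer v"
        unfolding g_def stab by auto
    qed
    ultimately have "range g \<subseteq> connected_component_set (torus_stabilizer v) (mat 1)"
      by (intro connected_component_maximal)
    then obtain t where t: "t \<noteq> 0" "g 1 = one_param \<mu> t"
      unfolding eq [symmetric] by blast
    \<comment> \<open>At \<open>s = 1\<close> the curve meets \<open>one_param \<mu> t\<close>;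
      norms give \<open>exp (x i)\<close> as a power of \<open>norm t\<close>, and logarithms make
      \<open>ln (norm t)\<close> the common factor.\<close>
    have "x i = ln (norm t) * of_int (\<mu> $ i)" for i
    proof -
      have "exp (complex_of_real (x i)) = t powi (\<mu> $ i)"
        using t(2) unfolding g_def one_param_eq_diag_mat diag_mat_eq_iff by (auto simp: fun_eq_iff)
      then have "norm (exp (complex_of_real (x i))) = norm (t powi (\<mu> $ i))"
        by simp
      then have "exp (x i) = norm t powi (\<mu> $ i)"
        by (simp add: norm_power_int)
      then have "x i = ln (norm t powi (\<mu> $ i))"
        by (metis ln_exp)
      then show ?thesis
        using t(1) by (subst (asm) powr_real_of_int' [symmetric]) (simp_all add: ln_powr)
    qed
    then show "\<exists>c. \<forall>i. x i = c * of_int (\<mu> $ i)"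
      by blast
  qed
qed

lemma admissible_imp_signs:
  fixes \<mu> :: "int ^ 'n"
  assumes ind: "indivisible \<mu>" and adm: "pminus_admissible \<mu>"
  shows "\<forall>i. \<mu> $ i \<in> {-1, 0, 1}"
    and "\<exists>p. \<mu> $ p \<noteq> 0 \<and> ((\<exists>q. \<mu> $ q = - \<mu> $ p) \<or> (\<forall>i. \<mu> $ i \<noteq> 0 \<longrightarrow> i = p))"
proof -
  obtain S where S: "\<And>i j. (i, j) \<in> S \<Longrightarrow> \<mu> $ i + \<mu> $ j = 0"
    and ker: "\<And>x :: 'n \<Rightarrow> real. (\<And>i j. (i, j) \<in> S \<Longrightarrow> x i + x j = 0) \<Longrightarrow> \<exists>c. \<forall>i. x i = c * of_int (\<mu> $ i)"
    using pminus_admissible_kernel [OF adm] by metis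
  \<comment> \<open>The zero vector is twice itself, hence divisible.\<close>
  have "\<exists>p. \<mu> $ p \<noteq> 0"
  proof (rule ccontr)
    assume "\<nexists>p. \<mu> $ p \<noteq> 0"
    then have "\<mu> = 2 *s \<mu>"
      by (simp add: vec_eq_iff)
    then show False
      using ind unfolding indivisible_def by (metis one_less_numeral_iff semiring_norm(76))
  qed
  then obtain p where p: "\<mu> $ p \<noteq> 0" by blast
  \<comment> \<open>Each pair in \<open>S\<close> has opposite entries of \<open>\<mu>\<close>,
    hence opposite signs, so the sign vector lies in the common kernel. Proportionality to
    \<open>\<mu>\<close> gives all nonzero entries the same absolute value.\<close>
  have "\<exists>c. \<forall>i. of_int (sgn (\<mu> $ i)) = (c::real) * of_int (\<mu> $ i)"
  proof (rule ker)
    fix i j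
    assume "(i, j) \<in> S"
    then have "\<mu> $ j = - \<mu> $ i" using S [of i j] by simp
    then show "of_int (sgn (\<mu> $ i)) + of_int (sgn (\<mu> $ j)) = (0::real)"
      by (simp add: sgn_minus)
  qed
  then obtain c :: real where c: "\<And>i. of_int (sgn (\<mu> $ i)) = c * of_int (\<mu> $ i)"
    by blast
  have c0: "c \<noteq> 0"
    using c [of p] p by (auto simp: sgn_0_0)
  have ab: "\<bar>\<mu> $ i\<bar> = \<bar>\<mu> $ p\<bar>" if "\<mu> $ i \<noteq> 0" for i
  proof -
    have abs_c: "\<bar>c\<bar> * of_int \<bar>\<mu> $ k\<bar> = 1" if "\<mu> $ k \<noteq> 0" for k
    proof -
      have "\<bar>c * of_int (\<mu> $ k)\<bar> = 1"
        using that unfolding c [of k, symmetric] by (simp add: abs_sgn_eq flip: of_int_abs)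
      then show ?thesis by (simp add: abs_mult)
    qed
    from abs_c [OF that] abs_c [OF p] have "\<bar>c\<bar> * of_int \<bar>\<mu> $ i\<bar> = \<bar>c\<bar> * of_int \<bar>\<mu> $ p\<bar>"
      by simp
    with c0 have "real_of_int \<bar>\<mu> $ i\<bar> = of_int \<bar>\<mu> $ p\<bar>"
      by (metis abs_eq_0 mult_cancel_left)
    then show ?thesis by (simp only: of_int_eq_iff)
  qed
  \<comment> \<open>The common absolute value is an integer factor of \<open>\<mu>\<close>, so
    indivisibility makes it 1.\<close>
  have "\<mu> = \<bar>\<mu> $ p\<bar> *s (\<chi> i. sgn (\<mu> $ i))"
  proof -
    have "\<mu> $ i = \<bar>\<mu> $ p\<bar> * sgn (\<mu> $ i)" for i
    proof (cases "\<mu> $ i = 0")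
      case False
      then show ?thesis by (simp flip: ab [OF False] add: abs_mult_sgn)
    qed simp
    then show ?thesis by (simp add: vec_eq_iff)
  qed
  then have "\<not> \<bar>\<mu> $ p\<bar> > 1"
    using ind unfolding indivisible_def by blast
  with p have "\<bar>\<mu> $ p\<bar> = 1" by linarith
  with ab have "\<bar>\<mu> $ i\<bar> = 1" if "\<mu> $ i \<noteq> 0" for i
    using that by simp
  then show "\<forall>i. \<mu> $ i \<in> {-1, 0, 1}"
    by (metis abs_eq_iff' insertCI abs_minus_cancel abs_one)
  \<comment> \<open>Without an entry opposite to \<open>\<mu> $ p\<close>, no pair in
    \<open>S\<close> involves \<open>p\<close>. The unit vector at \<open>p\<close> then lies in the
    kernel and is a nonzero multiple of \<open>\<mu>\<close>, so all other entries of
    \<open>\<mu>\<close> vanish.\<close>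
  have "\<forall>i. \<mu> $ i \<noteq> 0 \<longrightarrow> i = p" if no: "\<nexists>q. \<mu> $ q = - \<mu> $ p"
  proof -
    have "\<exists>c. \<forall>i. (if i = p then 1 else 0) = (c::real) * of_int (\<mu> $ i)"
    proof (rule ker)
      fix i j
      assume "(i, j) \<in> S"
      then have "\<mu> $ j = - \<mu> $ i" "\<mu> $ i = - \<mu> $ j" using S [of i j] by simp_all
      with no have "i \<noteq> p" "j \<noteq> p" by metis+
      then show "(if i = p then 1 else 0) + (if j = p then 1 else 0) = (0::real)"
        by simp
    qed
    then obtain c :: real where c: "\<And>i. (if i = p then 1 else 0) = c * of_int (\<mu> $ i)"
      by blast
    show ?thesis
      using c [of p] c by (metis (full_types) mult_eq_0_iff of_int_eq_0_iff zero_neq_one)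
  qed
  with p show "\<exists>p. \<mu> $ p \<noteq> 0 \<and> ((\<exists>q. \<mu> $ q = - \<mu> $ p) \<or> (\<forall>i. \<mu> $ i \<noteq> 0 \<longrightarrow> i = p))"
    by blast
qed

section \<open>Admissibility of sign vectors\<close>

definition kernel_form :: "int ^ 'n \<Rightarrow> complex ^ 'n \<Rightarrow> complex ^ 'n \<Rightarrow> complex" where
  "kernel_form \<mu> x y = (\<Sum>i\<in>UNIV. \<Sum>j\<in>UNIV. if \<mu> $ i + \<mu> $ j = 0 then x $ i * y $ j else 0)"

lemma kernel_form_commute: "kernel_form \<mu> x y = kernel_form \<mu> y x"
  unfolding kernel_form_def
  by (subst sum.swap) (intro sum.cong refl, simp add: add.commute mult.commute)

lemma kernel_form_in_pminus: "kernel_form \<mu> \<in> pminus"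
proof -
  have lin: "Vector_Spaces.linear (*s) (*) (\<lambda>y. kernel_form \<mu> x y)" for x
    unfolding Vector_Spaces.linear_iff
  proof (intro conjI allI)
    show "vector_space ((*s) :: complex \<Rightarrow> complex ^ 'n \<Rightarrow> _)"
      by (rule vec.vector_space_axioms)
    show "vector_space ((*) :: complex \<Rightarrow> _)"
      by (rule vector_space_over_itself.vector_space_axioms)
    show "kernel_form \<mu> x (y + z) = kernel_form \<mu> x y + kernel_form \<mu> x z" for y z
      unfolding kernel_form_def sum.distrib [symmetric]
      by (intro sum.cong refl) (simp add: distrib_left)
    show "kernel_form \<mu> x (c *s y) = c * kernel_form \<mu> x y" for c y
      unfolding kernel_form_def sum_distrib_left
      by (intro sum.cong refl) simp
  qed
  moreover have "(\<lambda>x. kernel_form \<mu> x y) = (\<lambda>x. kernel_form \<mu> y x)" for y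
    by (rule ext, rule kernel_form_commute)
  ultimately have "Vector_Spaces.linear (*s) (*) (\<lambda>x. kernel_form \<mu> x y)" for y
    by simp
  with lin show ?thesis
    unfolding pminus_def using kernel_form_commute by blast
qed

lemma kernel_form_axis: "kernel_form \<mu> (axis k 1) (axis l 1) = (if \<mu> $ k + \<mu> $ l = 0 then 1 else 0)"
proof -
  have "kernel_form \<mu> (axis k 1) (axis l 1) =
      (\<Sum>i\<in>UNIV. \<Sum>j\<in>UNIV. if j = l then if i = k then if \<mu> $ k + \<mu> $ l = 0 then 1 else 0 else 0 else 0)"
    unfolding kernel_form_def by (intro sum.cong refl) (simp add: axis_def)
  then show ?thesis by simp
qed

text \<open>Every weight vanishing on \<open>\<mu>\<close> occurs in
  \<open>kernel_form \<mu>\<close>, so its stabilizer is as small as that of any form fixed by the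
  image of \<open>\<mu>\<close>. The remaining task is to bound its identity component.\<close>

lemma signs_imp_admissible:
  fixes \<mu> :: "int ^ 'n"
  assumes signs: "\<forall>i. \<mu> $ i \<in> {-1, 0, 1}" and p: "\<mu> $ p \<noteq> 0"
    and pq: "(\<exists>q. \<mu> $ q = - \<mu> $ p) \<or> (\<forall>i. \<mu> $ i \<noteq> 0 \<longrightarrow> i = p)"
  shows "pminus_admissible \<mu>"
proof -
  let ?T = "torus_stabilizer (kernel_form \<mu>)"
  let ?C = "connected_component_set ?T (mat 1)"
  have stab: "?T = {diag_mat a | a. (\<forall>i. a i \<noteq> 0) \<and> (\<forall>i j. \<mu> $ i + \<mu> $ j = 0 \<longrightarrow> a i * a j = 1)}"
    unfolding torus_stabilizer_eq [OF kernel_form_in_pminus] kernel_form_axis by simp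
  have "one_param \<mu> ` (- {0}) \<subseteq> ?C"
  proof (rule connected_component_maximal)
    show "mat 1 \<in> one_param \<mu> ` (- {0})"
      by (rule image_eqI [of _ _ 1]) (simp_all add: one_param_eq_diag_mat mat_1_eq_diag_mat)
    have "continuous_on (- {0}) (one_param \<mu>)"
      unfolding one_param_eq_diag_mat [abs_def]
      by (rule continuous_on_diag_mat) (intro continuous_on_power_int continuous_on_id, simp)
    moreover have "connected (- {0 :: complex})"
      by (rule connected_punctured_universe) simp
    ultimately show "connected (one_param \<mu> ` (- {0}))"
      by (rule connected_continuous_image)
    show "one_param \<mu> ` (- {0}) \<subseteq> ?T"
    proof (rule image_subsetI)
      fix t :: complex
      assume "t \<in> - {0}"
      then have t: "t \<noteq> 0" by simp
      have "t powi (\<mu> $ i) * t powi (\<mu> $ j) = 1" if "\<mu> $ i + \<mu> $ j = 0" for i j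
        using t that by (simp flip: power_int_add)
      with t show "one_param \<mu> t \<in> ?T"
        unfolding one_param_eq_diag_mat stab by auto
    qed
  qed
  moreover have "?C \<subseteq> one_param \<mu> ` (- {0})"
  proof
    fix g
    assume g: "g \<in> ?C"
    then have "g \<in> ?T"
      using connected_component_subset by blast
    then obtain a where a: "g = diag_mat a" "\<And>i. a i \<noteq> 0"
      and a1: "\<And>i j. \<mu> $ i + \<mu> $ j = 0 \<Longrightarrow> a i * a j = 1"
      unfolding stab by blast
    \<comment> \<open>On the stabilizer such a diagonal entry squares to 1. Its values on the
      identity component form a connected subset of \<open>{1, -1}\<close> containing 1, so the only
      value is 1.\<close>
    have zero: "a i = 1" if i: "\<mu> $ i = 0" for i
    proof -
      let ?D = "(\<lambda>h. h $ i $ i) ` ?C"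
      have "connected ?D"
        by (intro connected_continuous_image continuous_intros connected_connected_component)
      moreover have "?D \<subseteq> {1, -1}"
      proof (rule image_subsetI)
        fix h
        assume "h \<in> ?C"
        then have "h \<in> ?T"
          using connected_component_subset by blast
        then obtain b where "h = diag_mat b" "b i * b i = 1"
          unfolding stab using i by fastforce
        then show "h $ i $ i \<in> {1, -1}"
          by (simp add: diag_mat_nth square_eq_1_iff)
      qed
      then have "finite ?D"
        by (rule finite_subset) simp
      ultimately have "?D = {} \<or> (\<exists>d. ?D = {d})"
        using connected_finite_iff_sing by blast
      moreover have "mat 1 \<in> ?C"
        using g connected_component_in connected_component_refl_eq by blast
      then have "1 \<in> ?D"
        by (rule image_eqI [rotated]) (simp add: mat_def)
      moreover have "a i \<in> ?D"
        using g by (rule image_eqI [rotated]) (simp add: a(1) diag_mat_nth)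
      ultimately show ?thesis
        by (metis empty_iff singletonD)
    qed
    have pp: "\<mu> $ p = 1 \<or> \<mu> $ p = - 1"
      using signs p by blast
    \<comment> \<open>As \<open>\<mu> $ p\<close> is 1 or -1, the parameter
      \<open>t = a p powi (\<mu> $ p)\<close> satisfies \<open>t powi (\<mu> $ p) = a p\<close>. The
      stabilizer relations carry this to the other indices.\<close>
    have "a i = (a p powi (\<mu> $ p)) powi (\<mu> $ i)" for i
    proof -
      consider "\<mu> $ i = 0" | "\<mu> $ i = - \<mu> $ p" | "\<mu> $ i = \<mu> $ p"
        using signs pp by (metis empty_iff insert_iff minus_minus)
      then show ?thesis
      proof cases
        case 1
        then show ?thesis by (simp add: zero)
      next
        case 2
        then have "a i * a p = 1" by (intro a1) simp
        then have "a i = inverse (a p)" by (metis inverse_unique mult.commute)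
        then show ?thesis using pp 2 by auto
      next
        case 3
        \<comment> \<open>Either both entries are inverse to \<open>a q\<close> for an opposite
          index \<open>q\<close>, or \<open>p\<close> is the only index with a nonzero
          entry.\<close>
        have "a i = a p"
          using pq
        proof
          assume "\<exists>q. \<mu> $ q = - \<mu> $ p"
          then obtain q where q: "\<mu> $ q = - \<mu> $ p" by blast
          then have "a i * a q = 1" "a p * a q = 1"
            using 3 by (simp_all add: a1)
          then show ?thesis by (metis a(2) mult_cancel_right)
        next
          assume "\<forall>i. \<mu> $ i \<noteq> 0 \<longrightarrow> i = p"
          then show ?thesis using 3 p by metis
        qed
        then show ?thesis using pp 3 by auto
      qed
    qed
    then have "g = one_param \<mu> (a p powi (\<mu> $ p))"
      unfolding one_param_eq_diag_mat a(1) diag_mat_eq_iff by blast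
    then show "g \<in> one_param \<mu> ` (- {0})"
      by (rule image_eqI) (simp add: a(2))
  qed
  ultimately show ?thesis
    unfolding pminus_admissible_def using kernel_form_in_pminus by blast
qed

lemma indivisible_admissible_iff:
  "indivisible \<mu> \<and> pminus_admissible \<mu> \<longleftrightarrow> (\<forall>i. \<mu> $ i \<in> {-1, 0, 1}) \<and>
    (\<exists>p. \<mu> $ p \<noteq> 0 \<and> ((\<exists>q. \<mu> $ q = - \<mu> $ p) \<or> (\<forall>i. \<mu> $ i \<noteq> 0 \<longrightarrow> i = p)))"
  (is "?L \<longleftrightarrow> ?R")
proof
  assume ?L
  then show ?R using admissible_imp_signs [of \<mu>] by blast
next
  assume R: ?R
  then obtain p where p: "\<mu> $ p \<noteq> 0" by blast
  have "indivisible \<mu>"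
    unfolding indivisible_def
  proof safe
    fix m \<nu>
    assume m: "m > (1::int)" "\<mu> = m *s \<nu>"
    \<comment> \<open>A nonzero entry is a unit of the integers, so a common factor \<open>m\<close>
      has absolute value 1.\<close>
    have "\<mu> $ p \<in> {-1, 0, 1}"
      using R by blast
    with p have "\<bar>\<mu> $ p\<bar> = 1"
      by auto
    then have "\<bar>m * \<nu> $ p\<bar> = 1"
      using m(2) by simp
    then have "\<bar>m\<bar> = 1"
      by (rule abs_zmult_eq_1)
    with m(1) show False by simp
  qed
  moreover have "pminus_admissible \<mu>"
    using R signs_imp_admissible by blast
  ultimately show ?L by blast
qed

section \<open>Positions in the linear order and dominant vectors\<close>

abbreviation pos_index :: "'n::{finite,linorder} \<Rightarrow> nat" where
  "pos_index i \<equiv> card {j. j < i}"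

lemma pos_index_less: "pos_index (i :: 'n::{finite,linorder}) < CARD('n)"
  by (rule psubset_card_mono) auto

lemma strict_mono_pos_index: "strict_mono (pos_index :: 'n::{finite,linorder} \<Rightarrow> nat)"
  by (rule strict_monoI, rule psubset_card_mono) auto

text \<open>The position, counted from 0, is injective by strict monotonicity, so equal
  cardinalities make it onto.\<close>

lemma range_pos_index: "range (pos_index :: 'n::{finite,linorder} \<Rightarrow> nat) = {..<CARD('n)}"
proof (rule card_subset_eq)
  show "card (range (pos_index :: 'n \<Rightarrow> nat)) = card {..<CARD('n)}"
    using card_image [OF strict_mono_imp_inj_on [OF strict_mono_pos_index]] by simp
qed (auto simp: pos_index_less)

lemma card_pos_index_less:
  assumes "k \<le> CARD('n::{finite,linorder})"
  shows "card {i :: 'n. pos_index i < k} = k"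
proof -
  have "card ((pos_index :: 'n \<Rightarrow> nat) -` {..<k}) = card {..<k}"
    using assms by (intro card_vimage_inj strict_mono_imp_inj_on strict_mono_pos_index) (auto simp: range_pos_index)
  then show ?thesis by (simp add: vimage_def)
qed

text \<open>The zeros end at position \<open>k + (CARD('n) - (k + l))\<close>; the bound on
  \<open>k + l\<close> keeps the truncated subtraction honest and turns this into
  \<open>CARD('n) - l\<close>.\<close>

lemma lam_nth:
  fixes i :: "'n::{finite,linorder}"
  assumes "k + l \<le> CARD('n)"
  shows "lam k l $ i =
    (if pos_index i < k then 1 else if pos_index i < CARD('n) - l then 0 else -1)"
  using assms pos_index_less [of i] by (auto simp: lam_def tuple_def nth_append)

text \<open>The parameters can be read off the vector, which later makes the parametrization
  injective.\<close>

lemma lam_counts: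
  assumes "k + l \<le> CARD('n::{finite,linorder})"
  shows "card {i :: 'n. lam k l $ i = 1} = k" and "card {i :: 'n. lam k l $ i = - 1} = l"
proof -
  have "{i :: 'n. lam k l $ i = 1} = {i. pos_index i < k}"
    using assms by (auto simp: lam_nth)
  then show "card {i :: 'n. lam k l $ i = 1} = k"
    using assms by (simp add: card_pos_index_less)
  have "{i :: 'n. lam k l $ i = - 1} = - {i. pos_index i < CARD('n) - l}"
    using assms by (auto simp: lam_nth)
  then show "card {i :: 'n. lam k l $ i = - 1} = l"
    using assms by (simp add: Compl_eq_Diff_UNIV card_Diff_subset card_pos_index_less)
qed

lemma dominant_lam:
  assumes "k + l \<le> CARD('n::{finite,linorder})"
  shows "dominant (lam k l :: int ^ 'n::{finite,linorder})"
  unfolding dominant_def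
proof safe
  fix i j :: 'n
  assume "i \<le> j"
  then have "pos_index i \<le> pos_index j"
    by (intro card_mono) auto
  then show "lam k l $ j \<le> (lam k l $ i :: int)"
    using assms by (auto simp: lam_nth)
qed

text \<open>Dominance puts the entries 1 in an initial segment and the entries -1 in a final one, so
  their numbers determine the vector.\<close>

lemma dominant_signs_eq_lam:
  fixes \<mu> :: "int ^ 'n::{finite,linorder}"
  assumes dom: "dominant \<mu>" and signs: "\<forall>i. \<mu> $ i \<in> {-1, 0, 1}"
  defines "k \<equiv> card {i. \<mu> $ i = 1}" and "l \<equiv> card {i. \<mu> $ i = - 1}"
  shows "k + l \<le> CARD('n)" and "\<mu> = lam k l"
proof -
  have mono: "\<mu> $ j \<le> \<mu> $ i" if "i \<le> j" for i j
    using dom that by (simp add: dominant_def)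
  have le1: "\<mu> $ i \<le> 1" "\<mu> $ i \<ge> -1" for i
    using signs [rule_format, of i] by auto
  have "k + l = card ({i. \<mu> $ i = 1} \<union> {i. \<mu> $ i = - 1})"
    unfolding k_def l_def by (rule card_Un_disjoint [symmetric]) auto
  also have "\<dots> \<le> CARD('n)"
    by (intro card_mono) auto
  finally show kl: "k + l \<le> CARD('n)" .
  \<comment> \<open>Including \<open>i\<close> itself adds one, which yields the strict inequalities
    in \<open>pos\<close> and \<open>neg\<close>.\<close>
  have Suc_pos_index: "Suc (pos_index i) = card {j. j \<le> i}" for i :: 'n
  proof -
    have "{j. j \<le> i} = insert i {j. j < i}" by auto
    then show ?thesis by simp
  qed
  have pos: "pos_index i < k \<longleftrightarrow> \<mu> $ i = 1" for i
  proof
    assume "\<mu> $ i = 1"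
    then have "\<mu> $ j = 1" if "j \<le> i" for j
      using mono [OF that] le1 [of j] by simp
    then have "card {j. j \<le> i} \<le> k"
      unfolding k_def by (intro card_mono) auto
    then show "pos_index i < k"
      by (simp flip: Suc_pos_index)
  next
    assume rk: "pos_index i < k"
    show "\<mu> $ i = 1"
    proof (rule ccontr)
      assume ne: "\<mu> $ i \<noteq> 1"
      \<comment> \<open>If the entry at \<open>i\<close> is below 1, all \<open>k\<close> entries 1
        come strictly earlier, so the position of \<open>i\<close> is at least
        \<open>k\<close>.\<close>
      have "j < i" if "\<mu> $ j = 1" for j
        using mono [of i j] ne le1 [of i] that by fastforce
      then have "k \<le> pos_index i"
        unfolding k_def by (intro card_mono) auto
      with rk show False by simp
    qed
  qed
  \<comment> \<open>The argument for \<open>pos\<close> is repeated with the initial segment of the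
    entries different from -1.\<close>
  have "card (- {i. \<mu> $ i = - 1}) = CARD('n) - l"
    unfolding l_def by (simp add: Compl_eq_Diff_UNIV card_Diff_subset)
  then have compl: "card {i. \<mu> $ i \<noteq> - 1} = CARD('n) - l"
    by (simp add: Compl_eq)
  have neg: "pos_index i < CARD('n) - l \<longleftrightarrow> \<mu> $ i \<noteq> - 1" for i
  proof
    assume "\<mu> $ i \<noteq> - 1"
    then have "\<mu> $ j \<noteq> - 1" if "j \<le> i" for j
      using mono [OF that] le1 [of i] by simp
    then have "card {j. j \<le> i} \<le> CARD('n) - l"
      unfolding compl [symmetric] by (intro card_mono) auto
    then show "pos_index i < CARD('n) - l"
      by (simp flip: Suc_pos_index)
  next
    assume rk: "pos_index i < CARD('n) - l"
    show "\<mu> $ i \<noteq> - 1"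
    proof
      assume eq: "\<mu> $ i = - 1"
      have "j < i" if "\<mu> $ j \<noteq> - 1" for j
        using mono [of i j] eq le1 [of j] that by fastforce
      then have "CARD('n) - l \<le> pos_index i"
        unfolding compl [symmetric] by (intro card_mono) auto
      with rk show False by simp
    qed
  qed
  show "\<mu> = lam k l"
    using signs by (auto simp: vec_eq_iff lam_nth [OF kl] pos neg)
qed

text \<open>A single nonzero entry corresponds to the parameters \<open>(1, 0)\<close> or
  \<open>(0, 1)\<close>; a pair of opposite entries means that both counts are positive, which is
  the Sigma set.\<close>

lemma dominant_indivisible_admissible_iff:
  fixes \<mu> :: "int ^ 'n::{finite,linorder}"
  assumes "CARD('n) \<ge> 2"
  shows "dominant \<mu> \<and> indivisible \<mu> \<and> pminus_admissible \<mu> \<longleftrightarrow>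
    (\<exists>(k, l) \<in> {(1, 0), (0, 1)} \<union> Sigma {1..CARD('n) - 1} (\<lambda>k. {1..CARD('n) - k}). \<mu> = lam k l)"
    (is "?L \<longleftrightarrow> ?R")
proof
  assume ?L
  then have signs: "\<forall>i. \<mu> $ i \<in> {-1, 0, 1}" and dom: "dominant \<mu>"
    and "\<exists>p. \<mu> $ p \<noteq> 0 \<and> ((\<exists>q. \<mu> $ q = - \<mu> $ p) \<or> (\<forall>i. \<mu> $ i \<noteq> 0 \<longrightarrow> i = p))"
    using indivisible_admissible_iff [of \<mu>] by blast+
  then obtain p where p: "\<mu> $ p \<noteq> 0" "(\<exists>q. \<mu> $ q = - \<mu> $ p) \<or> (\<forall>i. \<mu> $ i \<noteq> 0 \<longrightarrow> i = p)"
    by blast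
  define k l where "k = card {i. \<mu> $ i = 1}" and "l = card {i. \<mu> $ i = - 1}"
  note kl = dominant_signs_eq_lam [OF dom signs, folded k_def l_def]
  have pp: "\<mu> $ p = 1 \<or> \<mu> $ p = - 1"
    using signs p by blast
  have "(k, l) \<in> {(1, 0), (0, 1)} \<union> Sigma {1..CARD('n) - 1} (\<lambda>k. {1..CARD('n) - k})"
    using p(2)
  proof
    assume "\<exists>q. \<mu> $ q = - \<mu> $ p"
    with pp have "{i. \<mu> $ i = 1} \<noteq> {}" "{i. \<mu> $ i = - 1} \<noteq> {}"
      by fastforce+
    then have "k \<noteq> 0" "l \<noteq> 0"
      unfolding k_def l_def by simp_all
    with kl(1) show ?thesis by auto
  next
    assume u: "\<forall>i. \<mu> $ i \<noteq> 0 \<longrightarrow> i = p"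
    from pp show ?thesis
    proof
      assume "\<mu> $ p = 1"
      with u have "\<mu> $ i = (if i = p then 1 else 0)" for i by auto
      then show ?thesis by (simp add: k_def l_def)
    next
      assume "\<mu> $ p = - 1"
      with u have "\<mu> $ i = (if i = p then - 1 else 0)" for i by auto
      then show ?thesis by (simp add: k_def l_def)
    qed
  qed
  with kl(2) show ?R by blast
next
  assume ?R
  then obtain k l where kl: "(k, l) \<in> {(1, 0), (0, 1)} \<union> Sigma {1..CARD('n) - 1} (\<lambda>k. {1..CARD('n) - k})"
    and \<mu>: "\<mu> = lam k l"
    by blast
  then have le: "k + l \<le> CARD('n)"
    using assms by auto
  note counts = lam_counts [OF le, folded \<mu>]
  have signs: "\<forall>i. \<mu> $ i \<in> {-1, 0, 1}"
    by (simp add: \<mu> lam_nth [OF le])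
  have "\<exists>p. \<mu> $ p \<noteq> 0 \<and> ((\<exists>q. \<mu> $ q = - \<mu> $ p) \<or> (\<forall>i. \<mu> $ i \<noteq> 0 \<longrightarrow> i = p))"
  proof -
    consider "k = 1" "l = 0" | "k = 0" "l = 1" | "k \<noteq> 0" "l \<noteq> 0"
      using kl by auto
    then show ?thesis
    proof cases
      case 1
      then obtain p where "{i. \<mu> $ i = 1} = {p}" "{i. \<mu> $ i = - 1} = {}"
        using counts by (metis card_1_singletonE card_eq_0_iff finite)
      with signs show ?thesis by (intro exI [of _ p]) fastforce
    next
      case 2
      then obtain p where "{i. \<mu> $ i = - 1} = {p}" "{i. \<mu> $ i = 1} = {}"
        using counts by (metis card_1_singletonE card_eq_0_iff finite)
      with signs show ?thesis by (intro exI [of _ p]) fastforce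
    next
      case 3
      then have "{i. \<mu> $ i = 1} \<noteq> {}" "{i. \<mu> $ i = - 1} \<noteq> {}"
        using counts by (metis card.empty)+
      then obtain p q where "\<mu> $ p = 1" "\<mu> $ q = - 1" by blast
      then show ?thesis by (intro exI [of _ p]) auto
    qed
  qed
  with signs show ?L
    using indivisible_admissible_iff [of \<mu>] dominant_lam [OF le, folded \<mu>] by blast
qed

section \<open>The explicit list and its cardinality\<close>

theorem mainTheorem14:
  assumes "CARD('n::{finite,linorder}) \<ge> 2"
  shows "{\<mu> :: int ^ 'n::{finite,linorder}. dominant \<mu> \<and> indivisible \<mu> \<and> pminus_admissible \<mu>} =
           {tuple (1 # replicate (CARD('n) - 1) 0), tuple (replicate (CARD('n) - 1) 0 @ [- 1])}
           \<union> {lam k l | k l. k \<in> {1..CARD('n) - 1} \<and> l \<in> {1..CARD('n) - k}}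
         \<and> card {\<mu> :: int ^ 'n::{finite,linorder}. dominant \<mu> \<and> indivisible \<mu> \<and> pminus_admissible \<mu>} =
             CARD('n) * (CARD('n) - 1) div 2 + 2"
proof
  let ?n = "CARD('n)"
  let ?A = "{\<mu> :: int ^ 'n::{finite,linorder}. dominant \<mu> \<and> indivisible \<mu> \<and> pminus_admissible \<mu>}"
  let ?S = "Sigma {1..?n - 1} (\<lambda>k. {1..?n - k})"
  let ?I = "{(1, 0), (0, 1)} \<union> ?S"
  have image_Sigma: "(\<lambda>(k, l). f k l) ` Sigma X Y = {f k l | k l. k \<in> X \<and> l \<in> Y k}"
    for f :: "nat \<Rightarrow> nat \<Rightarrow> int ^ 'n::{finite,linorder}" and X Y
    by (fastforce simp: image_iff)
  have A: "?A = (\<lambda>(k, l). lam k l) ` ?I"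
    using dominant_indivisible_admissible_iff [OF assms] by auto
  have "tuple (1 # replicate (?n - 1) 0) = (lam 1 0 :: int ^ 'n::{finite,linorder})"
    "tuple (replicate (?n - 1) 0 @ [- 1]) = (lam 0 1 :: int ^ 'n::{finite,linorder})"
    by (simp_all add: lam_def)
  then show "?A = {tuple (1 # replicate (?n - 1) 0), tuple (replicate (?n - 1) 0 @ [- 1])}
      \<union> {lam k l | k l. k \<in> {1..?n - 1} \<and> l \<in> {1..?n - k}}"
    unfolding A image_Un image_Sigma by auto
  have "inj_on (\<lambda>(k, l). lam k l :: int ^ 'n::{finite,linorder}) ?I"
  proof (rule inj_onI, clarify)
    fix k l k' l'
    assume "(k, l) \<in> ?I" "(k', l') \<in> ?I" and eq: "lam k l = (lam k' l' :: int ^ 'n::{finite,linorder})"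
    then have "k + l \<le> ?n" "k' + l' \<le> ?n"
      using assms by auto
    from lam_counts [OF this(1)] lam_counts [OF this(2)] show "k = k' \<and> l = l'"
      unfolding eq by simp
  qed
  then have "card ?A = card ?I"
    unfolding A by (rule card_image)
  \<comment> \<open>The two exceptional pairs have a zero component, while both components are at
    least 1 in \<open>?S\<close>.\<close>
  also have "\<dots> = card {(1::nat, 0::nat), (0, 1)} + card ?S"
    by (rule card_Un_disjoint) auto
  also have "card ?S = (\<Sum>k = 1..?n - 1. ?n - k)"
    by simp
  \<comment> \<open>Reversing the order of summation by \<open>k \<mapsto> ?n - k\<close> gives a
    triangular number.\<close>
  also have "\<dots> = (\<Sum>k = 1..?n - 1. k)"
    by (rule sum.reindex_bij_witness [of _ "\<lambda>k. ?n - k" "\<lambda>k. ?n - k"]) auto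
  also have "\<dots> = ?n * (?n - 1) div 2"
    using Sum_Icc_nat [of 1 "?n - 1"] assms by (simp add: mult.commute)
  finally show "card ?A = ?n * (?n - 1) div 2 + 2"
    by simp
qed

end
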